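(* Let $G=(X,+,\leq)$ be an ordered group. (1) The order $\leq$ is a semiorder if and only if there are a compatible total quasi-order $\preceq$ on $G$ and a normal final segment $F$ of $(X,\preceq)$ not containing $0$ such that, for all $x,y\in X$, $x<y$ in $G$ if and only if $y-x\in F$. (2) The order $\leq$ is a threshold order if and only if there are a compatible total order $\preceq$ on $G$ and a nonempty normal final segment $F$ of $(X,\preceq)$ not containing $0$ such that: (a) for all $x,y\in X$, $x<y$ in $G$ if and only if $y-x\in F$; (b) $I:=X\setminus(-F\cup F)$ is not a union of cosets of a normal convex subgroup of $(X,+,\preceq)$ distinct from $\{0\}$. When conditions (a) and (b) are satisfied, the auxiliary order $\preceq$ coincides with $\leq_{pred}$.
   Context: Groups are written additively but are not assumed abelian. A quasi-order is a reflexive transitive relation; it is total if any two elements are related in at least one direction. A quasi-order on a group is compatible if it is preserved by all left and right translations; an ordered group is a group with a compatible partial order. A subset $F$ of a group is normal if $-x+F+x\subseteq F$ for every $x$. A final segment of $(X,\preceq)$ is a subset $F$ such that $x\in F$ and $x\preceq y$ imply $y\in F$. A subset is convex if it contains every element lying between two of its elements. An order is a semiorder if it embeds neither $2\oplus 2$ nor $3\oplus 1$, where $r\oplus s$ is the disjoint union of an $r$-element chain and an $s$-element chain with no comparabilities between them, and an embedding is a one-to-one map $f$ with $f(x)\leq f(y)$ iff $x\leq y$. For an order $\leq$ with strict order $<$, $x\leq_{pred}y$ means that for all $z$, $z<x$ implies $z<y$, and $x\leq_{succ}y$ means that for all $z$, $y<z$ implies $x<z$. A threshold order is an order for which $\leq_{pred}$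 and $\leq_{succ}$ are total orders and are equal.
   Formalization: The equivalence in (2) is stated only for groups with a nonzero element: on the one-element group the order is a threshold order, but no nonempty F can avoid 0, so the equivalence fails there. *)

theory Defs
  imports Main
begin

definition quasi_order :: "('a \<Rightarrow> 'a \<Rightarrow> bool) \<Rightarrow> bool" where
  "quasi_order le \<longleftrightarrow> reflp le \<and> transp le"

definition partial_order :: "('a \<Rightarrow> 'a \<Rightarrow> bool) \<Rightarrow> bool" where
  "partial_order le \<longleftrightarrow> quasi_order le \<and> antisymp le"

definition total_quasi_order :: "('a \<Rightarrow> 'a \<Rightarrow> bool) \<Rightarrow> bool" where
  "total_quasi_order le \<longleftrightarrow> quasi_order le \<and> totalp le"

definition total_order :: "('a \<Rightarrow> 'a \<Rightarrow> bool) \<Rightarrow> bool" where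
  "total_order le \<longleftrightarrow> partial_order le \<and> totalp le"

(* Only used for partial orders, where it is the usual strict order. *)
definition strict :: "('a \<Rightarrow> 'a \<Rightarrow> bool) \<Rightarrow> 'a \<Rightarrow> 'a \<Rightarrow> bool" where
  "strict le x y \<longleftrightarrow> le x y \<and> x \<noteq> y"

definition final_segment :: "('a \<Rightarrow> 'a \<Rightarrow> bool) \<Rightarrow> 'a set \<Rightarrow> bool" where
  "final_segment le F \<longleftrightarrow> (\<forall>x y. x \<in> F \<and> le x y \<longrightarrow> y \<in> F)"

definition order_convex :: "('a \<Rightarrow> 'a \<Rightarrow> bool) \<Rightarrow> 'a set \<Rightarrow> bool" where
  "order_convex le C \<longleftrightarrow> (\<forall>x\<in>C. \<forall>z\<in>C. \<forall>y. le x y \<and> le y z \<longrightarrow> y \<in> C)"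

definition order_embeds ::
  "'b set \<Rightarrow> ('b \<Rightarrow> 'b \<Rightarrow> bool) \<Rightarrow> ('a \<Rightarrow> 'a \<Rightarrow> bool) \<Rightarrow> bool" where
  "order_embeds B r le \<longleftrightarrow>
     (\<exists>f. inj_on f B \<and> (\<forall>x\<in>B. \<forall>y\<in>B. le (f x) (f y) \<longleftrightarrow> r x y))"

(* The order r \<oplus> s has carrier {..<r} <+> {..<s}; rel_sum compares two elements
   only if they lie in the same summand. *)
definition embeds_chain_sum :: "nat \<Rightarrow> nat \<Rightarrow> ('a \<Rightarrow> 'a \<Rightarrow> bool) \<Rightarrow> bool" where
  "embeds_chain_sum r s le \<longleftrightarrow>
     order_embeds ({..<r} <+> {..<s}) (rel_sum (\<le>) (\<le>)) le"

definition semiorder :: "('a \<Rightarrow> 'a \<Rightarrow> bool) \<Rightarrow> bool" where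
  "semiorder le \<longleftrightarrow>
     partial_order le \<and> \<not> embeds_chain_sum 2 2 le \<and> \<not> embeds_chain_sum 3 1 le"

definition pred_le :: "('a \<Rightarrow> 'a \<Rightarrow> bool) \<Rightarrow> 'a \<Rightarrow> 'a \<Rightarrow> bool" where
  "pred_le le x y \<longleftrightarrow> (\<forall>z. strict le z x \<longrightarrow> strict le z y)"

definition succ_le :: "('a \<Rightarrow> 'a \<Rightarrow> bool) \<Rightarrow> 'a \<Rightarrow> 'a \<Rightarrow> bool" where
  "succ_le le x y \<longleftrightarrow> (\<forall>z. strict le y z \<longrightarrow> strict le x z)"

definition threshold_order :: "('a \<Rightarrow> 'a \<Rightarrow> bool) \<Rightarrow> bool" where
  "threshold_order le \<longleftrightarrow>
     partial_order le \<and> total_order (pred_le le) \<and> total_order (succ_le le) \<and>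
     pred_le le = succ_le le"

(* The class group_add does not assume commutativity. *)
definition compatible :: "('a::group_add \<Rightarrow> 'a \<Rightarrow> bool) \<Rightarrow> bool" where
  "compatible le \<longleftrightarrow> (\<forall>a x y. le x y \<longrightarrow> le (a + x) (a + y) \<and> le (x + a) (y + a))"

definition normal_set :: "'a::group_add set \<Rightarrow> bool" where
  "normal_set F \<longleftrightarrow> (\<forall>x. (\<lambda>f. - x + f + x) ` F \<subseteq> F)"

definition additive_subgroup :: "'a::group_add set \<Rightarrow> bool" where
  "additive_subgroup H \<longleftrightarrow>
     0 \<in> H \<and> (\<forall>x\<in>H. \<forall>y\<in>H. x + y \<in> H) \<and> (\<forall>x\<in>H. - x \<in> H)"

(* Left cosets; this is only used for normal subgroups, where they are also the
   right cosets. *)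
definition union_of_cosets :: "'a::group_add set \<Rightarrow> 'a set \<Rightarrow> bool" where
  "union_of_cosets H A \<longleftrightarrow> (\<exists>S. A = (\<Union>x\<in>S. (\<lambda>h. x + h) ` H))"

end

theory Submission
  imports Defs
begin

text \<open>
  The auxiliary order is \<open>\<le>\<^sub>p\<^sub>r\<^sub>e\<^sub>d\<close>, and the final segment is the set of strictly positive elements.
  In an ordered group \<open>\<le>\<^sub>p\<^sub>r\<^sub>e\<^sub>d\<close> is a compatible quasi-order equal to \<open>\<le>\<^sub>s\<^sub>u\<^sub>c\<^sub>c\<close>, because the order
  depends only on differences, and a predecessor of \<open>x\<close> at some distance corresponds to a
  successor of \<open>y\<close> at that distance (lemma \<open>pred_le_eq_succ_le\<close>). Thus only totality
  and antisymmetry of \<open>\<le>\<^sub>p\<^sub>r\<^sub>e\<^sub>d\<close> remain to be understood.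

  Totality is the semiorder property: two elements that \<open>\<le>\<^sub>p\<^sub>r\<^sub>e\<^sub>d\<close> does not compare, each with a
  witness below it, form a copy of \<open>2 \<oplus> 2\<close>. Conversely, a compatible total quasi-order in which
  the positive elements form a final segment excludes both forbidden configurations, since it
  compares two elements of the configuration, and differences move up with that comparison.

  Antisymmetry is condition (b). The elements equivalent to \<open>0\<close> under \<open>\<le>\<^sub>p\<^sub>r\<^sub>e\<^sub>d\<close> form a normal
  subgroup, convex for every compatible total order in which the positive elements are a final
  segment. The set \<open>I\<close> of the elements neither strictly above nor strictly below \<open>0\<close> is a union
  of its cosets, so (b) forces it to be trivial. Conversely, if \<open>I\<close> is a union of cosets of a normal subgroup
  convex for \<open>\<le>\<^sub>p\<^sub>r\<^sub>e\<^sub>d\<close>, that subgroup consists of elements equivalent to \<open>0\<close>, hence is trivial if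
  \<open>\<le>\<^sub>p\<^sub>r\<^sub>e\<^sub>d\<close> is antisymmetric. Finally, a total order contained in an antisymmetric
  relation equals it, which gives uniqueness.
\<close>

section \<open>Forbidden configurations of semiorders\<close>

lemma strict_trans:
  assumes "partial_order le" "strict le x y" "strict le y z"
  shows "strict le x z"
  using assms unfolding partial_order_def quasi_order_def strict_def
  by (metis antisympD transpD)

lemma strict_irrefl: "\<not> strict le x x"
  by (simp add: strict_def)

lemma le_iff_strict:
  assumes "partial_order le"
  shows "le x y \<longleftrightarrow> strict le x y \<or> x = y"
  using assms unfolding partial_order_def quasi_order_def strict_def
  by (metis reflpD)

lemma lessThan_two: "{..<2::nat} = {0, 1}"
  by auto

lemma lessThan_three: "{..<3::nat} = {0, 1, 2}"
  by auto

text \<open>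
  Two missing strict comparisons are enough: together with the two chains, transitivity makes
  them exclude all other comparisons and all coincidences between the chains.
\<close>

lemma embeds_two_two_iff:
  assumes "partial_order le"
  shows "embeds_chain_sum 2 2 le \<longleftrightarrow>
    (\<exists>a b c d. strict le a b \<and> strict le c d \<and> \<not> strict le a d \<and> \<not> strict le c b)"
proof
  assume "embeds_chain_sum 2 2 le"
  then obtain f :: "nat + nat \<Rightarrow> 'a" where
    inj: "inj_on f ({..<2} <+> {..<2})" and
    emb: "\<forall>x\<in>{..<2} <+> {..<2}. \<forall>y\<in>{..<2} <+> {..<2}. le (f x) (f y) \<longleftrightarrow> rel_sum (\<le>) (\<le>) x y"
    unfolding embeds_chain_sum_def order_embeds_def by blast
  have strict_f: "strict le (f x) (f y) \<longleftrightarrow> rel_sum (\<le>) (\<le>) x y \<and> x \<noteq> y"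
    if "x \<in> {..<2} <+> {..<2}" "y \<in> {..<2} <+> {..<2}" for x y
    using that emb by (simp add: strict_def inj_on_eq_iff[OF inj])
  have "strict le (f (Inl 0)) (f (Inl 1))" "strict le (f (Inr 0)) (f (Inr 1))"
    by (simp_all add: strict_f InlI InrI)
  moreover have "\<not> strict le (f (Inl 0)) (f (Inr 1))" "\<not> strict le (f (Inr 0)) (f (Inl 1))"
    by (simp_all add: strict_f InlI InrI)
  ultimately show
    "\<exists>a b c d. strict le a b \<and> strict le c d \<and> \<not> strict le a d \<and> \<not> strict le c b"
    by blast
next
  assume "\<exists>a b c d. strict le a b \<and> strict le c d \<and> \<not> strict le a d \<and> \<not> strict le c b"
  then obtain a b c d where
    abcd: "strict le a b" "strict le c d" "\<not> strict le a d" "\<not> strict le c b"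
    by blast
  have le_ab: "le a b" and le_cd: "le c d" and neq: "a \<noteq> b" "c \<noteq> d"
    using abcd by (auto simp: strict_def)
  have refl: "le x x" for x
    using assms by (simp add: le_iff_strict)
  have incomparable: "\<not> le a c" "\<not> le a d" "\<not> le b c" "\<not> le b d" "\<not> le c a" "\<not> le c b" "\<not> le d a" "\<not> le d b"
    and not_rev: "\<not> le b a" "\<not> le d c"
    using abcd strict_trans[OF assms] strict_irrefl[of le] le_iff_strict[OF assms] by (smt (verit))+
  define f where "f = case_sum (\<lambda>i::nat. if i = 0 then a else b) (\<lambda>j::nat. if j = 0 then c else d)"
  have "inj_on f ({..<2} <+> {..<2})"
    using neq incomparable refl unfolding inj_on_def f_def by (auto simp: lessThan_two)
  moreover have "\<forall>x\<in>{..<2} <+> {..<2}. \<forall>y\<in>{..<2} <+> {..<2}.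
      le (f x) (f y) \<longleftrightarrow> rel_sum (\<le>) (\<le>) x y"
    using le_ab le_cd incomparable not_rev refl unfolding f_def by (auto simp: lessThan_two)
  ultimately show "embeds_chain_sum 2 2 le"
    unfolding embeds_chain_sum_def order_embeds_def by blast
qed

lemma embeds_three_one_iff:
  assumes "partial_order le"
  shows "embeds_chain_sum 3 1 le \<longleftrightarrow>
    (\<exists>a b c d. strict le a b \<and> strict le b c \<and> \<not> strict le a d \<and> \<not> strict le d c)"
proof
  assume "embeds_chain_sum 3 1 le"
  then obtain f :: "nat + nat \<Rightarrow> 'a" where
    inj: "inj_on f ({..<3} <+> {..<1})" and
    emb: "\<forall>x\<in>{..<3} <+> {..<1}. \<forall>y\<in>{..<3} <+> {..<1}. le (f x) (f y) \<longleftrightarrow> rel_sum (\<le>) (\<le>) x y"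
    unfolding embeds_chain_sum_def order_embeds_def by blast
  have strict_f: "strict le (f x) (f y) \<longleftrightarrow> rel_sum (\<le>) (\<le>) x y \<and> x \<noteq> y"
    if "x \<in> {..<3} <+> {..<1}" "y \<in> {..<3} <+> {..<1}" for x y
    using that emb by (simp add: strict_def inj_on_eq_iff[OF inj])
  have "strict le (f (Inl 0)) (f (Inl 1))" "strict le (f (Inl 1)) (f (Inl 2))"
    by (simp_all add: strict_f InlI InrI)
  moreover have "\<not> strict le (f (Inl 0)) (f (Inr 0))" "\<not> strict le (f (Inr 0)) (f (Inl 2))"
    by (simp_all add: strict_f InlI InrI)
  ultimately show
    "\<exists>a b c d. strict le a b \<and> strict le b c \<and> \<not> strict le a d \<and> \<not> strict le d c"
    by blast
next
  assume "\<exists>a b c d. strict le a b \<and> strict le b c \<and> \<not> strict le a d \<and> \<not> strict le d c"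
  then obtain a b c d where
    abcd: "strict le a b" "strict le b c" "\<not> strict le a d" "\<not> strict le d c"
    by blast
  have ac: "strict le a c"
    using abcd strict_trans[OF assms] by blast
  have chain: "le a b" "le b c" "le a c" and neq: "a \<noteq> b" "b \<noteq> c" "a \<noteq> c"
    using abcd ac by (auto simp: strict_def)
  have refl: "le x x" for x
    using assms by (simp add: le_iff_strict)
  have incomparable: "\<not> le a d" "\<not> le b d" "\<not> le c d" "\<not> le d a" "\<not> le d b" "\<not> le d c"
    and not_rev: "\<not> le b a" "\<not> le c b" "\<not> le c a"
    using abcd ac strict_trans[OF assms] strict_irrefl[of le] le_iff_strict[OF assms] by (smt (verit))+
  define f where
    "f = case_sum (\<lambda>i::nat. if i = 0 then a else if i = 1 then b else c) (\<lambda>j::nat. d)"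
  have "inj_on f ({..<3} <+> {..<1})"
    using neq incomparable refl unfolding inj_on_def f_def by (auto simp: lessThan_three)
  moreover have "\<forall>x\<in>{..<3} <+> {..<1}. \<forall>y\<in>{..<3} <+> {..<1}.
      le (f x) (f y) \<longleftrightarrow> rel_sum (\<le>) (\<le>) x y"
    using chain incomparable not_rev refl unfolding f_def by (auto simp: lessThan_three)
  ultimately show "embeds_chain_sum 3 1 le"
    unfolding embeds_chain_sum_def order_embeds_def by blast
qed

lemma semiorder_iff:
  assumes "partial_order le"
  shows "semiorder le \<longleftrightarrow>
    (\<forall>a b c d. strict le a b \<and> strict le c d \<longrightarrow> strict le a d \<or> strict le c b) \<and>
    (\<forall>a b c d. strict le a b \<and> strict le b c \<longrightarrow> strict le a d \<or> strict le d c)"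
proof -
  have "\<not> embeds_chain_sum 2 2 le \<longleftrightarrow>
    (\<forall>a b c d. strict le a b \<and> strict le c d \<longrightarrow> strict le a d \<or> strict le c b)"
    by (simp only: embeds_two_two_iff[OF assms] not_ex de_Morgan_conj not_not imp_conv_disj disj_assoc)
  moreover have "\<not> embeds_chain_sum 3 1 le \<longleftrightarrow>
    (\<forall>a b c d. strict le a b \<and> strict le b c \<longrightarrow> strict le a d \<or> strict le d c)"
    by (simp only: embeds_three_one_iff[OF assms] not_ex de_Morgan_conj not_not imp_conv_disj disj_assoc)
  ultimately show ?thesis
    using assms by (simp only: semiorder_def simp_thms)
qed

section \<open>The order by predecessors\<close>

lemma quasi_order_pred_le: "quasi_order (pred_le le)"
  unfolding quasi_order_def pred_le_def by (auto intro: reflpI transpI)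

lemma pred_le_trans: "pred_le le x y \<Longrightarrow> pred_le le y z \<Longrightarrow> pred_le le x z"
  by (simp add: pred_le_def)

lemma strict_imp_pred_le:
  assumes "partial_order le" "strict le x y"
  shows "pred_le le x y"
  using strict_trans[OF assms(1) _ assms(2)] by (simp add: pred_le_def)

lemma final_segment_pred_le: "final_segment (pred_le le) {y. strict le x y}"
  by (auto simp: final_segment_def pred_le_def)

text \<open>
  Witnesses \<open>z < x\<close> and \<open>w < y\<close> against the two comparisons of \<open>x\<close> and \<open>y\<close> form, with \<open>x\<close> and
  \<open>y\<close>, the excluded sum of two chains.
\<close>

lemma totalp_pred_le:
  assumes "semiorder le"
  shows "totalp (pred_le le)"
proof (rule totalpI)
  fix x y
  have "partial_order le"
    using assms by (simp add: semiorder_def)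
  then have two_chains: "strict le a d \<or> strict le c b"
    if "strict le a b" "strict le c d" for a b c d
    using assms that unfolding semiorder_iff[OF \<open>partial_order le\<close>] by blast
  show "pred_le le x y \<or> pred_le le y x"
  proof (rule ccontr)
    assume "\<not> ?thesis"
    then obtain z w where "strict le z x" "\<not> strict le z y" "strict le w y" "\<not> strict le w x"
      unfolding pred_le_def by blast
    then show False
      using two_chains[of z x w y] by simp
  qed
qed

section \<open>Compatible relations\<close>

lemma compatible_left_iff:
  assumes "compatible r"
  shows "r (a + x) (a + y) \<longleftrightarrow> r x y"
proof
  assume "r (a + x) (a + y)"
  then have "r (- a + (a + x)) (- a + (a + y))"
    using assms unfolding compatible_def by blast
  then show "r x y"
    by (simp add: add.assoc[symmetric])
qed (use assms in \<open>simp add: compatible_def\<close>)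

lemma compatible_right_iff:
  assumes "compatible r"
  shows "r (x + a) (y + a) \<longleftrightarrow> r x y"
proof
  assume "r (x + a) (y + a)"
  then have "r (x + a + - a) (y + a + - a)"
    using assms unfolding compatible_def by blast
  then show "r x y"
    by (simp add: add.assoc)
qed (use assms in \<open>simp add: compatible_def\<close>)

lemma compatible_iff_diff:
  assumes "compatible r"
  shows "r x y \<longleftrightarrow> r 0 (y - x)"
  using compatible_right_iff[OF assms, of x "- x" y] by simp

lemma compatible_iff_minus:
  assumes "compatible r"
  shows "r (- y) (- x) \<longleftrightarrow> r x y"
  using compatible_right_iff[OF assms, of "- y" y "- x"]
    compatible_left_iff[OF assms, of "x" "0" "- x + y"]
  by (simp add: add.assoc[symmetric])

lemma compatible_strict:
  assumes "compatible le"
  shows "compatible (strict le)"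
  using assms by (auto simp: compatible_def strict_def)

lemma normal_set_positive:
  assumes "compatible r"
  shows "normal_set {x. r 0 x}"
proof -
  have "r 0 (- x + f + x)" if "r 0 f" for x f
    using that compatible_left_iff[OF assms, of "- x" 0 f]
      compatible_right_iff[OF assms, of "- x" x "- x + f"] by simp
  then show ?thesis
    by (auto simp: normal_set_def)
qed

lemma compatible_pred_le:
  assumes "compatible le"
  shows "compatible (pred_le le)"
proof -
  note strict = compatible_strict[OF assms]
  have left: "strict le z (a + x) \<longleftrightarrow> strict le (- a + z) x" for z a x
    using compatible_left_iff[OF strict, of a "- a + z" x] by (simp add: add.assoc[symmetric])
  have right: "strict le z (x + a) \<longleftrightarrow> strict le (z - a) x" for z a x
    using compatible_right_iff[OF strict, of "z - a" a x] by simp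
  have "pred_le le (a + x) (a + y)" "pred_le le (x + a) (y + a)" if "pred_le le x y" for a x y
    using that unfolding pred_le_def left[of _ a] right[of _ _ a] by blast+
  then show ?thesis
    by (simp add: compatible_def)
qed

text \<open>
  If \<open>y < z\<close>, then \<open>x - z + y\<close> is a predecessor of \<open>x\<close>; it is a predecessor of \<open>y\<close> exactly if
  \<open>x < z\<close>. So testing predecessors of \<open>x\<close> and testing successors of \<open>y\<close> is the same.
\<close>

lemma pred_le_eq_succ_le:
  assumes "compatible le"
  shows "pred_le le = succ_le le"
proof (intro ext)
  fix x y
  note strict = compatible_strict[OF assms]
  have shift: "strict le (x - z + y) y \<longleftrightarrow> strict le x z"
    "strict le (x - z + y) x \<longleftrightarrow> strict le y z" for z
    using compatible_right_iff[OF strict, of "x - z" y 0]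
      compatible_right_iff[OF strict, of x "- z" z]
      compatible_left_iff[OF strict, of x "- z + y" 0]
      compatible_left_iff[OF strict, of z "- z + y" 0]
    by (simp_all add: add.assoc[symmetric])
  have surj: "\<exists>z. w = x - z + y" for w
    by (rule exI[of _ "y - w + x"]) (simp add: minus_add diff_conv_add_uminus add.assoc del: add_uminus_conv_diff)
  show "pred_le le x y = succ_le le x y"
    unfolding pred_le_def succ_le_def using shift surj by metis
qed

section \<open>Differences in a final segment\<close>

lemma difference_set_eq_positive:
  fixes F :: "'a::group_add set"
  assumes "\<forall>x y. strict le x y \<longleftrightarrow> y - x \<in> F"
  shows "F = {x. strict le 0 x}"
proof -
  have "x \<in> F \<longleftrightarrow> strict le 0 x" for x
    using assms[rule_format, of 0 x] by simp
  then show ?thesis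
    by blast
qed

lemma comparable_to_zero:
  fixes le :: "'a::group_add \<Rightarrow> 'a \<Rightarrow> bool"
  assumes "compatible le"
  shows "uminus ` {x. strict le 0 x} \<union> {x. strict le 0 x} = {x. strict le x 0 \<or> strict le 0 x}"
proof -
  have "strict le x 0 \<longleftrightarrow> strict le 0 (- x)" for x
    using compatible_iff_diff[OF compatible_strict[OF assms], of x 0] by simp
  moreover have "x \<in> uminus ` A \<longleftrightarrow> - x \<in> A" for x :: 'a and A
    by force
  ultimately show ?thesis
    by auto
qed

text \<open>
  Raising \<open>x\<close> in the auxiliary quasi-order raises each difference \<open>x - z\<close>, and so keeps it in the
  final segment.
\<close>

lemma imp_pred_le:
  assumes "compatible q" "final_segment q F" "\<forall>x y. strict le x y \<longleftrightarrow> y - x \<in> F" "q x y"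
  shows "pred_le le x y"
  unfolding pred_le_def
proof (intro allI impI)
  fix z
  assume "strict le z x"
  moreover have "q (x - z) (y - z)"
    using assms(4) compatible_right_iff[OF assms(1), of x "- z" y] by simp
  ultimately show "strict le z y"
    using assms(2,3) unfolding final_segment_def by blast
qed

text \<open>
  Comparing the tops of \<open>2 \<oplus> 2\<close>, or the middle of the long chain of \<open>3 \<oplus> 1\<close> with the isolated
  element, in \<open>\<le>\<^sub>p\<^sub>r\<^sub>e\<^sub>d\<close> yields a comparison between the two chains that these sums lack; if the
  isolated element comes first, it does so because \<open>\<le>\<^sub>p\<^sub>r\<^sub>e\<^sub>d\<close> is also \<open>\<le>\<^sub>s\<^sub>u\<^sub>c\<^sub>c\<close>.
\<close>

lemma semiorder_if_total_pred_le:
  assumes "partial_order le" "compatible le" and total: "\<And>x y. pred_le le x y \<or> pred_le le y x"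
  shows "semiorder le"
  unfolding semiorder_iff[OF assms(1)]
proof (intro conjI allI impI; elim conjE)
  fix a b c d
  assume "strict le a b" "strict le c d"
  then show "strict le a d \<or> strict le c b"
    using total[of b d] unfolding pred_le_def by blast
next
  fix a b c d
  assume "strict le a b" "strict le b c"
  moreover have "pred_le le b d \<or> succ_le le d b"
    using total[of b d] by (simp add: pred_le_eq_succ_le[OF assms(2)])
  ultimately show "strict le a d \<or> strict le d c"
    unfolding pred_le_def succ_le_def by blast
qed

section \<open>The kernel of the order by predecessors\<close>

definition pred_kernel :: "('a::group_add \<Rightarrow> 'a \<Rightarrow> bool) \<Rightarrow> 'a set" where
  "pred_kernel le = {h. pred_le le 0 h \<and> pred_le le h 0}"

lemma subgroup_pred_kernel:
  assumes "compatible le"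
  shows "additive_subgroup (pred_kernel le)"
proof -
  note pred = compatible_pred_le[OF assms]
  have add: "x + y \<in> pred_kernel le" if "x \<in> pred_kernel le" "y \<in> pred_kernel le" for x y
    using that compatible_left_iff[OF pred, of x 0 y] compatible_left_iff[OF pred, of x y 0]
    by (auto simp: pred_kernel_def intro: pred_le_trans)
  have "- x \<in> pred_kernel le" if "x \<in> pred_kernel le" for x
    using that compatible_iff_minus[OF pred, of x 0] compatible_iff_minus[OF pred, of 0 x]
    by (simp add: pred_kernel_def)
  moreover have "0 \<in> pred_kernel le"
    by (simp add: pred_kernel_def pred_le_def)
  ultimately show ?thesis
    using add by (simp add: additive_subgroup_def)
qed

lemma normal_pred_kernel:
  assumes "compatible le"
  shows "normal_set (pred_kernel le)"
proof -
  have "compatible (\<lambda>x y. pred_le le x y \<and> pred_le le y x)"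
    using compatible_pred_le[OF assms] by (simp add: compatible_def)
  from normal_set_positive[OF this] show ?thesis
    by (simp add: pred_kernel_def)
qed

lemma convex_pred_kernel:
  assumes "\<And>x y. r x y \<Longrightarrow> pred_le le x y"
  shows "order_convex r (pred_kernel le)"
  using assms unfolding order_convex_def pred_kernel_def by (blast intro: pred_le_trans)

text \<open>
  An element \<open>x + h\<close> with \<open>h\<close> in the kernel is equivalent to \<open>x\<close> under \<open>\<le>\<^sub>p\<^sub>r\<^sub>e\<^sub>d\<close> and \<open>\<le>\<^sub>s\<^sub>u\<^sub>c\<^sub>c\<close>, hence
  lies above or below \<open>0\<close> exactly if \<open>x\<close> does.
\<close>

lemma incomparable_union_of_cosets_pred_kernel:
  assumes "compatible le"
  shows "union_of_cosets (pred_kernel le) (UNIV - {x. strict le x 0 \<or> strict le 0 x})"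
    (is "union_of_cosets ?H ?I")
proof -
  note pred = compatible_pred_le[OF assms]
  have "x + h \<in> ?I" if "x \<in> ?I" "h \<in> ?H" for x h
  proof -
    have "pred_le le (x + h) x" "pred_le le x (x + h)"
      using that(2) compatible_left_iff[OF pred, of x h 0] compatible_left_iff[OF pred, of x 0 h]
      by (simp_all add: pred_kernel_def)
    then have "pred_le le (x + h) x" "succ_le le x (x + h)"
      by (simp_all add: pred_le_eq_succ_le[OF assms])
    then show ?thesis
      using that(1) by (auto simp: pred_le_def succ_le_def)
  qed
  moreover have "x \<in> (\<lambda>h. x + h) ` ?H" for x
    using subgroup_pred_kernel[OF assms] by (force simp: additive_subgroup_def)
  ultimately have "?I = (\<Union>x\<in>?I. (\<lambda>h. x + h) ` ?H)"
    by blast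
  then show ?thesis
    unfolding union_of_cosets_def by blast
qed

lemma union_of_cosets_add_mem:
  assumes "additive_subgroup H" "union_of_cosets H A" "x \<in> A" "h \<in> H"
  shows "x + h \<in> A"
proof -
  obtain S where S: "A = (\<Union>x\<in>S. (\<lambda>h. x + h) ` H)"
    using assms(2) unfolding union_of_cosets_def by blast
  then obtain s k where "s \<in> S" "k \<in> H" "x = s + k"
    using assms(3) by blast
  moreover have "k + h \<in> H"
    using assms(1,4) \<open>k \<in> H\<close> by (simp add: additive_subgroup_def)
  ultimately show ?thesis
    unfolding S by (auto simp: add.assoc)
qed

text \<open>
  Let \<open>z < 0\<close> and \<open>h \<in> H\<close>. Then \<open>- h + z\<close> lies in the coset of \<open>z\<close>, so it is strictly
  comparable to \<open>0\<close>.
  If it is negative, then \<open>z < h\<close>. If it is positive, then \<open>z\<close> lies between \<open>h\<close> and \<open>0\<close>, so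
  convexity puts \<open>z\<close> in \<open>H\<close>, which is impossible because \<open>z\<close> would lie in the coset of \<open>0\<close>. Hence
  every \<open>h\<close> in \<open>H\<close> is above \<open>0\<close> in \<open>\<le>\<^sub>p\<^sub>r\<^sub>e\<^sub>d\<close>, and so is its inverse.
\<close>

lemma convex_subgroup_subset_pred_kernel:
  assumes "partial_order le" "compatible le"
    and subgroup: "additive_subgroup H" and normal: "normal_set H"
    and convex: "order_convex (pred_le le) H"
    and cosets: "union_of_cosets H (UNIV - {x. strict le x 0 \<or> strict le 0 x})"
  shows "H \<subseteq> pred_kernel le"
proof -
  note strict = compatible_strict[OF assms(2)]
  let ?I = "UNIV - {x. strict le x 0 \<or> strict le 0 x}"
  have neg: "- h \<in> H" if "h \<in> H" for h
    using subgroup that by (simp add: additive_subgroup_def)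
  have conj: "- x + h + x \<in> H" if "h \<in> H" for x h
    using normal that by (auto simp: normal_set_def)
  have above: "pred_le le 0 h" if h: "h \<in> H" for h
    unfolding pred_le_def
  proof (intro allI impI)
    fix z
    assume z: "strict le z 0"
    have shift: "strict le (- h + z) 0 \<longleftrightarrow> strict le z h" "strict le 0 (- h + z) \<longleftrightarrow> strict le h z"
      using compatible_left_iff[OF strict, of h "- h + z" 0]
        compatible_left_iff[OF strict, of h 0 "- h + z"]
      by (simp_all add: add.assoc[symmetric])
    have "- h + z \<notin> ?I"
    proof
      assume "- h + z \<in> ?I"
      from union_of_cosets_add_mem[OF subgroup cosets this conj[OF h, of z]] have "z \<in> ?I"
        by (simp add: add.assoc[symmetric])
      with z show False
        by simp
    qed
    moreover have "\<not> strict le h z"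
    proof
      assume "strict le h z"
      then have "z \<in> H"
        using z h convex subgroup strict_imp_pred_le[OF assms(1)]
        unfolding order_convex_def additive_subgroup_def by blast
      then have "z \<in> ?I"
        using union_of_cosets_add_mem[OF subgroup cosets, of 0 z] by (simp add: strict_irrefl)
      with z show False
        by simp
    qed
    ultimately show "strict le z h"
      by (simp add: shift)
  qed
  have "pred_le le h 0" if "h \<in> H" for h
    using above[OF neg[OF that]] compatible_iff_minus[OF compatible_pred_le[OF assms(2)], of 0 h]
    by simp
  with above show ?thesis
    by (auto simp: pred_kernel_def)
qed

section \<open>Threshold orders\<close>

lemma pred_kernel_trivial_if_antisymp:
  assumes "antisymp (pred_le le)"
  shows "pred_kernel le = {0}"
  using assms by (auto simp: pred_kernel_def pred_le_def dest: antisympD)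

text \<open>
  Condition (b), applied to the kernel, makes \<open>\<le>\<^sub>p\<^sub>r\<^sub>e\<^sub>d\<close> antisymmetric; as it contains the given total
  order, the two agree.
\<close>

lemma total_order_eq_pred_le:
  assumes "compatible le" "total_order tle" "compatible tle" "final_segment tle F"
    and diff: "\<forall>x y. strict le x y \<longleftrightarrow> y - x \<in> F"
    and no_subgroup: "\<not> (\<exists>H. additive_subgroup H \<and> normal_set H \<and> order_convex tle H \<and> H \<noteq> {0} \<and>
           union_of_cosets H (UNIV - (uminus ` F \<union> F)))"
  shows "tle = pred_le le"
proof -
  note pred = compatible_pred_le[OF assms(1)]
  have imp: "pred_le le x y" if "tle x y" for x y
    using imp_pred_le[OF assms(3,4) diff that] .
  have I: "uminus ` F \<union> F = {x. strict le x 0 \<or> strict le 0 x}"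
    using comparable_to_zero[OF assms(1)] by (simp add: difference_set_eq_positive[OF diff])
  have kernel: "pred_kernel le = {0}"
    using no_subgroup subgroup_pred_kernel[OF assms(1)] normal_pred_kernel[OF assms(1)]
      convex_pred_kernel[of tle le] imp incomparable_union_of_cosets_pred_kernel[OF assms(1)]
    unfolding I by blast
  have antisym: "x = y" if "pred_le le x y" "pred_le le y x" for x y
  proof -
    have "pred_le le 0 (y - x)" "pred_le le (y - x) 0"
      using that compatible_right_iff[OF pred, of x "- x" y] compatible_right_iff[OF pred, of y "- x" x]
      by simp_all
    then have "y - x \<in> pred_kernel le"
      by (simp add: pred_kernel_def)
    then show ?thesis
      by (simp add: kernel)
  qed
  have "tle x y" if "pred_le le x y" for x y
    using that imp antisym assms(2)
    unfolding total_order_def partial_order_def quasi_order_def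
    by (metis reflpD totalpD)
  with imp show ?thesis
    by blast
qed

theorem proposition11:
  fixes le :: "'a::group_add \<Rightarrow> 'a \<Rightarrow> bool"
  assumes "partial_order le" and "compatible le"
  shows
    "(semiorder le \<longleftrightarrow>
       (\<exists>qle F. total_quasi_order qle \<and> compatible qle \<and>
          normal_set F \<and> final_segment qle F \<and> 0 \<notin> F \<and>
          (\<forall>x y. strict le x y \<longleftrightarrow> y - x \<in> F)))
     \<and>
     ((\<exists>x::'a. x \<noteq> 0) \<longrightarrow>
       (threshold_order le \<longleftrightarrow>
         (\<exists>tle F. total_order tle \<and> compatible tle \<and>
            F \<noteq> {} \<and> normal_set F \<and> final_segment tle F \<and> 0 \<notin> F \<and>
            (\<forall>x y. strict le x y \<longleftrightarrow> y - x \<in> F) \<and>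
            \<not> (\<exists>H. additive_subgroup H \<and> normal_set H \<and> order_convex tle H \<and> H \<noteq> {0} \<and>
                 union_of_cosets H (UNIV - (uminus ` F \<union> F))))))
     \<and>
     (\<forall>tle F. total_order tle \<and> compatible tle \<and>
        F \<noteq> {} \<and> normal_set F \<and> final_segment tle F \<and> 0 \<notin> F \<and>
        (\<forall>x y. strict le x y \<longleftrightarrow> y - x \<in> F) \<and>
        \<not> (\<exists>H. additive_subgroup H \<and> normal_set H \<and> order_convex tle H \<and> H \<noteq> {0} \<and>
             union_of_cosets H (UNIV - (uminus ` F \<union> F)))
        \<longrightarrow> tle = pred_le le)"
proof -
  note po = assms(1) and comp = assms(2)
  note strict = compatible_strict[OF comp] and pred = compatible_pred_le[OF comp]
  let ?P = "{x. strict le 0 x}"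
  have P: "normal_set ?P" "final_segment (pred_le le) ?P" "0 \<notin> ?P"
    "\<forall>x y. strict le x y \<longleftrightarrow> y - x \<in> ?P"
    using normal_set_positive[OF strict] final_segment_pred_le[of le 0] compatible_iff_diff[OF strict]
    by (auto simp: strict_irrefl)
  have semi_iff: "semiorder le \<longleftrightarrow>
       (\<exists>qle F. total_quasi_order qle \<and> compatible qle \<and>
          normal_set F \<and> final_segment qle F \<and> 0 \<notin> F \<and>
          (\<forall>x y. strict le x y \<longleftrightarrow> y - x \<in> F))" (is "_ \<longleftrightarrow> ?aux")
  proof
    assume "semiorder le"
    then have "total_quasi_order (pred_le le)"
      using totalp_pred_le quasi_order_pred_le by (auto simp: total_quasi_order_def)
    with P pred show ?aux
      by blast
  next
    assume ?aux
    then obtain qle F where q: "total_quasi_order qle" "compatible qle" "final_segment qle F"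
      "\<forall>x y. strict le x y \<longleftrightarrow> y - x \<in> F"
      by blast
    have "qle x y \<or> qle y x" for x y
      using q(1) unfolding total_quasi_order_def quasi_order_def by (metis reflpD totalpD)
    then have "pred_le le x y \<or> pred_le le y x" for x y
      using imp_pred_le[OF q(2-4)] by blast
    then show "semiorder le"
      by (rule semiorder_if_total_pred_le[OF po comp])
  qed
  let ?thr = "\<lambda>tle F. total_order tle \<and> compatible tle \<and>
        F \<noteq> {} \<and> normal_set F \<and> final_segment tle F \<and> 0 \<notin> F \<and>
        (\<forall>x y. strict le x y \<longleftrightarrow> y - x \<in> F) \<and>
        \<not> (\<exists>H. additive_subgroup H \<and> normal_set H \<and> order_convex tle H \<and> H \<noteq> {0} \<and>
             union_of_cosets H (UNIV - (uminus ` F \<union> F)))"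
  have unique: "\<forall>tle F. ?thr tle F \<longrightarrow> tle = pred_le le"
    using total_order_eq_pred_le[OF comp] by blast
  have threshold_iff: "threshold_order le \<longleftrightarrow> (\<exists>tle F. ?thr tle F)" if nontrivial: "\<exists>x::'a. x \<noteq> 0"
  proof
    assume "threshold_order le"
    then have total: "total_order (pred_le le)"
      by (simp add: threshold_order_def)
    then have antisym: "antisymp (pred_le le)"
      by (simp add: total_order_def partial_order_def)
    \<comment> \<open>With nothing positive, \<open>\<le>\<^sub>p\<^sub>r\<^sub>e\<^sub>d\<close> would relate all elements, and antisymmetry would identify them.\<close>
    have "?P \<noteq> {}"
    proof
      assume "?P = {}"
      then have "\<not> strict le x y" for x y
        using P(4) by blast
      then have "pred_le le x y" for x y
        by (simp add: pred_le_def)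
      with antisym nontrivial show False
        by (metis antisympD)
    qed
    moreover have "H = {0}" if "additive_subgroup H" "normal_set H" "order_convex (pred_le le) H"
      "union_of_cosets H (UNIV - (uminus ` ?P \<union> ?P))" for H
    proof -
      have "H \<subseteq> {0}"
        using convex_subgroup_subset_pred_kernel[OF po comp that(1-3)] that(4)
          pred_kernel_trivial_if_antisymp[OF antisym]
        unfolding comparable_to_zero[OF comp] by simp
      with that(1) show ?thesis
        by (auto simp: additive_subgroup_def)
    qed
    ultimately have "?thr (pred_le le) ?P"
      using total pred P by blast
    then show "\<exists>tle F. ?thr tle F"
      by blast
  next
    assume "\<exists>tle F. ?thr tle F"
    with unique have "total_order (pred_le le)"
      by metis
    with po pred_le_eq_succ_le[OF comp] show "threshold_order le"
      by (simp add: threshold_order_def)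
  qed
  show ?thesis
    using semi_iff threshold_iff unique by blast
qed

end
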